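(* Assume (A0), (A1) and (A2) and set $I^0=\emptyset$. Then, for every set $D$ with $G_{\le0}\subseteq D\subseteq G$ and every $w\in\mathbb R^G$, the sequence $(\tilde v^k)\subseteq\mathbb R^D$ defined by the subroutine $\textsc{SolveImpulseControl}(w,D)$ is monotone increasing for $k\ge1$ and converges to the unique solution $\tilde v\in\mathbb R^D$ of $$\max\{\tilde L\tilde v+\tilde f,\ \tilde M\tilde v-\tilde v\}=0 .$$
   Context: Grid and operators. $G$ is a symmetric grid $x_{-N}=-x_N<\dots<x_{-1}=-x_1<x_0=0<x_1<\dots<x_N$ of real numbers; $\mathbb R^G$ is the set of functions $G\to\mathbb R$ (vectors), linear operators on $\mathbb R^G$ are identified with matrices in $\mathbb R^{G\times G}$, and orders, max, argmax are pointwise (elementwise). $G_{<0}$, $G_{\le0}$ are the sets of negative, resp. nonpositive, grid points; complements are taken in $G$. $f\in\mathbb R^G$ and $L:\mathbb R^G\to\mathbb R^G$ is linear. For each $x\in G$, $Z(x)\subseteq\mathbb R$ is a finite nonempty set, with $Z(x)=\{0\}$ if $x\ge0$; $Z=\prod_{x\in G}Z(x)$. For each $\delta\in Z$, $B(\delta):\mathbb R^G\to\mathbb R^G$ is linear and $c(\delta)\in(0,+\infty)^G$; both are row-decoupled: row $x$ of $B(\delta)$ and of $c(\delta)$ depends only on $\delta(x)$. Set $Mv=\max_{\delta\in Z}\{B(\delta)v-c(\delta)\}$. Strategies. $\Phi=\{\varphi=(I,\delta): I\subseteq G_{<0},\ \delta\in Z\}$. Matrix notions. For a real square matrix $A$: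 row $i$ is WDD (resp. SDD) if $|A_{ii}|\ge\sum_{j\ne i}|A_{ij}|$ (resp. $>$); $A$ is WDD (SDD) if all rows are; $A$ is an $L_0$-matrix if its off-diagonal entries are $\le0$ and its diagonal entries are $\ge0$. graph$A$ is the directed graph on the row indices with an edge $(i,j)$ iff $A_{ij}\neq0$; a walk is a nonempty finite sequence of consecutive edges. Assumptions. (A0) For each $\varphi=(I,\delta)\in\Phi$ and $x\in I$ there is a walk in graph$B(\delta)$ from row $x$ to some row $y\in I^c$. (A1) $-L$ is an SDD $L_0$-matrix and, for each $\delta\in Z$, $\operatorname{Id}-B(\delta)$ is a WDD $L_0$-matrix. (A2) $B(\delta)$ has nonnegative diagonal elements for all $\delta\in Z$. Restricted problem. For $v\in\mathbb R^G$, $v_D$ is its restriction to $D$; for a matrix $O$, $O_{IJ}$ is the submatrix with rows in $I$ and columns in $J$. Define $\tilde L=L_{DD}$, $\tilde f=f_D+L_{DD^c}w_{D^c}$, $\tilde Z=\prod_{x\in D}Z(x)$, and for $\tilde\delta\in\tilde Z$, $\tilde B(\tilde\delta)=B(\tilde\delta)_{DD}$ and $\tilde c(\tilde\delta)=c(\tilde\delta)-B(\tilde\delta)_{DD^c}w_{D^c}$ (rows indexed by $D$), and $\tilde M\tilde v=\max_{\tilde\delta\in\tilde Z}\{\tilde B(\tilde\delta)\tilde v-\tilde c(\tilde\delta)\}$ for $\tilde v\in\mathbb R^D$. Subroutine $\textsc{SolveImpulseControl}(w,D)$ (the infinite iteration, i.e. without the stopping test). Fix a scaling factor $\lambda>0$,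 an initial guess $\tilde v^0\in\mathbb R^D$ and $I^0\subseteq G_{<0}$. For $k=0,1,2,\dots$, $\tilde v^{k+1}\in\mathbb R^D$ is the solution of the linear system $$(\tilde L\tilde v^{k+1}+\tilde f)(x)=0\ \text{ for }x\in D\setminus I^k,\qquad \tilde v^{k+1}(x)=(\tilde M\tilde v^k)(x)\ \text{ for }x\in I^k,$$ and then $I^{k+1}=\{\tilde L\tilde v^{k+1}+\tilde f\le\lambda(\tilde M\tilde v^{k+1}-\tilde v^{k+1})\}$ (the subroutine's intervention regions are understood as subsets of $G_{<0}$).
   Formalization: With regions cut to negative points the iteration may miss the solution, as Mv≤v at x≥0 is not enforced; so convergence is claimed if regions are tested on all of D, or if they are cut to negative points and rows x≥0 of B(δ) are identity rows. *)

theory Defs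
  imports Complex_Main "HOL-Library.FuncSet"
begin

text \<open>
  A vector in \<open>\<real>\<^sup>S\<close> (\<open>S\<close> a finite set of reals) is a function in \<open>S \<rightarrow>\<^sub>E UNIV\<close>, so that equality
  of vectors is equality on \<open>S\<close>. A linear operator is given by its matrix; only the entries with
  both indices in the grid are ever used, and likewise only the values of data on the grid.
\<close>

definition vecs :: "real set \<Rightarrow> (real \<Rightarrow> real) set" where
  "vecs S = (S \<rightarrow>\<^sub>E UNIV)"

definition mat_vec :: "real set \<Rightarrow> (real \<Rightarrow> real \<Rightarrow> real) \<Rightarrow> (real \<Rightarrow> real) \<Rightarrow> real \<Rightarrow> real" where
  "mat_vec S A v x = (\<Sum>y\<in>S. A x y * v y)"

definition symmetric_grid :: "real set \<Rightarrow> bool" where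
  "symmetric_grid G \<longleftrightarrow>
     (\<exists>(N::nat) (g :: int \<Rightarrow> real). 1 \<le> N \<and> g 0 = 0 \<and>
        (\<forall>i\<in>{- int N..int N}. g (- i) = - g i) \<and>
        strict_mono_on {- int N..int N} g \<and>
        G = g ` {- int N..int N})"

definition wdd :: "real set \<Rightarrow> (real \<Rightarrow> real \<Rightarrow> real) \<Rightarrow> bool" where
  "wdd S A \<longleftrightarrow> (\<forall>i\<in>S. \<bar>A i i\<bar> \<ge> (\<Sum>j\<in>S - {i}. \<bar>A i j\<bar>))"

definition sdd :: "real set \<Rightarrow> (real \<Rightarrow> real \<Rightarrow> real) \<Rightarrow> bool" where
  "sdd S A \<longleftrightarrow> (\<forall>i\<in>S. \<bar>A i i\<bar> > (\<Sum>j\<in>S - {i}. \<bar>A i j\<bar>))"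

definition L0_matrix :: "real set \<Rightarrow> (real \<Rightarrow> real \<Rightarrow> real) \<Rightarrow> bool" where
  "L0_matrix S A \<longleftrightarrow> (\<forall>i\<in>S. 0 \<le> A i i \<and> (\<forall>j\<in>S - {i}. A i j \<le> 0))"

definition mat_graph :: "real set \<Rightarrow> (real \<Rightarrow> real \<Rightarrow> real) \<Rightarrow> (real \<times> real) set" where
  "mat_graph S A = {(i, j). i \<in> S \<and> j \<in> S \<and> A i j \<noteq> 0}"

definition id_mat :: "real \<Rightarrow> real \<Rightarrow> real" where
  "id_mat x y = (if x = y then 1 else 0)"

record impulse_problem =
  grid :: "real set"
  opL :: "real \<Rightarrow> real \<Rightarrow> real"
  src :: "real \<Rightarrow> real"
  impZ :: "real \<Rightarrow> real set"
  opB :: "(real \<Rightarrow> real) \<Rightarrow> real \<Rightarrow> real \<Rightarrow> real"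
  cost :: "(real \<Rightarrow> real) \<Rightarrow> real \<Rightarrow> real"

definition controls :: "impulse_problem \<Rightarrow> (real \<Rightarrow> real) set" where
  "controls P = (\<Pi>\<^sub>E x\<in>grid P. impZ P x)"

definition grid_neg :: "impulse_problem \<Rightarrow> real set" where
  "grid_neg P = {x \<in> grid P. x < 0}"

definition grid_nonpos :: "impulse_problem \<Rightarrow> real set" where
  "grid_nonpos P = {x \<in> grid P. x \<le> 0}"

definition impulse_setting :: "impulse_problem \<Rightarrow> bool" where
  "impulse_setting P \<longleftrightarrow>
     symmetric_grid (grid P) \<and>
     (\<forall>x\<in>grid P. finite (impZ P x) \<and> impZ P x \<noteq> {} \<and> (0 \<le> x \<longrightarrow> impZ P x = {0})) \<and>
     (\<forall>\<delta>\<in>controls P. \<forall>x\<in>grid P. 0 < cost P \<delta> x) \<and>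
     (\<forall>\<delta>\<in>controls P. \<forall>\<delta>'\<in>controls P. \<forall>x\<in>grid P. \<delta> x = \<delta>' x \<longrightarrow>
        cost P \<delta> x = cost P \<delta>' x \<and> (\<forall>y\<in>grid P. opB P \<delta> x y = opB P \<delta>' x y))"

definition A0 :: "impulse_problem \<Rightarrow> bool" where
  "A0 P \<longleftrightarrow>
     (\<forall>I \<delta>. I \<subseteq> grid_neg P \<and> \<delta> \<in> controls P \<longrightarrow>
        (\<forall>x\<in>I. \<exists>y\<in>grid P - I. (x, y) \<in> (mat_graph (grid P) (opB P \<delta>))\<^sup>+))"

definition A1 :: "impulse_problem \<Rightarrow> bool" where
  "A1 P \<longleftrightarrow>
     sdd (grid P) (\<lambda>x y. - opL P x y) \<and> L0_matrix (grid P) (\<lambda>x y. - opL P x y) \<and>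
     (\<forall>\<delta>\<in>controls P. wdd (grid P) (\<lambda>x y. id_mat x y - opB P \<delta> x y) \<and>
        L0_matrix (grid P) (\<lambda>x y. id_mat x y - opB P \<delta> x y))"

definition A2 :: "impulse_problem \<Rightarrow> bool" where
  "A2 P \<longleftrightarrow> (\<forall>\<delta>\<in>controls P. \<forall>x\<in>grid P. 0 \<le> opB P \<delta> x x)"

text \<open>
  The restricted problem on \<open>D\<close>. A control on \<open>D\<close> is extended to the whole grid by \<open>0\<close>. When
  \<open>D\<close> contains the nonpositive grid points, this is its only extension to an element of
  \<open>controls P\<close>, because \<open>Z(x) = {0}\<close> at the positive points.
\<close>

definition extend_control :: "impulse_problem \<Rightarrow> real set \<Rightarrow> (real \<Rightarrow> real) \<Rightarrow> real \<Rightarrow> real" where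
  "extend_control P D \<delta> = (\<lambda>x\<in>grid P. if x \<in> D then \<delta> x else 0)"

definition controls_res :: "impulse_problem \<Rightarrow> real set \<Rightarrow> (real \<Rightarrow> real) set" where
  "controls_res P D = (\<Pi>\<^sub>E x\<in>D. impZ P x)"

definition src_res :: "impulse_problem \<Rightarrow> (real \<Rightarrow> real) \<Rightarrow> real set \<Rightarrow> real \<Rightarrow> real" where
  "src_res P w D x = src P x + mat_vec (grid P - D) (opL P) w x"

definition opB_res :: "impulse_problem \<Rightarrow> real set \<Rightarrow> (real \<Rightarrow> real) \<Rightarrow> real \<Rightarrow> real \<Rightarrow> real" where
  "opB_res P D \<delta> = opB P (extend_control P D \<delta>)"

definition cost_res ::
  "impulse_problem \<Rightarrow> (real \<Rightarrow> real) \<Rightarrow> real set \<Rightarrow> (real \<Rightarrow> real) \<Rightarrow> real \<Rightarrow> real" where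
  "cost_res P w D \<delta> x =
     cost P (extend_control P D \<delta>) x - mat_vec (grid P - D) (opB_res P D \<delta>) w x"

definition pde_res ::
  "impulse_problem \<Rightarrow> (real \<Rightarrow> real) \<Rightarrow> real set \<Rightarrow> (real \<Rightarrow> real) \<Rightarrow> real \<Rightarrow> real" where
  "pde_res P w D v x = mat_vec D (opL P) v x + src_res P w D x"

definition opM_res ::
  "impulse_problem \<Rightarrow> (real \<Rightarrow> real) \<Rightarrow> real set \<Rightarrow> (real \<Rightarrow> real) \<Rightarrow> real \<Rightarrow> real" where
  "opM_res P w D v x =
     Max ((\<lambda>\<delta>. mat_vec D (opB_res P D \<delta>) v x - cost_res P w D \<delta> x) ` controls_res P D)"

definition qvi_solution ::
  "impulse_problem \<Rightarrow> (real \<Rightarrow> real) \<Rightarrow> real set \<Rightarrow> (real \<Rightarrow> real) \<Rightarrow> bool" where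
  "qvi_solution P w D v \<longleftrightarrow>
     v \<in> vecs D \<and> (\<forall>x\<in>D. max (pde_res P w D v x) (opM_res P w D v x - v x) = 0)"

definition step_system ::
  "impulse_problem \<Rightarrow> (real \<Rightarrow> real) \<Rightarrow> real set \<Rightarrow> real set \<Rightarrow> (real \<Rightarrow> real) \<Rightarrow> (real \<Rightarrow> real) \<Rightarrow> bool"
where
  "step_system P w D I v v' \<longleftrightarrow>
     v' \<in> vecs D \<and>
     (\<forall>x\<in>D - I. pde_res P w D v' x = 0) \<and>
     (\<forall>x\<in>I. v' x = opM_res P w D v x)"

text \<open>
  The parameter \<open>R\<close> is the set of points at which the intervention regions are tested:
  \<open>R = D\<close> gives \<open>I\<^sup>k\<^sup>+\<^sup>1 = {x \<in> D. \<dots>}\<close>, and \<open>R = grid_neg P\<close> keeps the regions inside the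
  negative points.
\<close>

definition next_region ::
  "impulse_problem \<Rightarrow> real \<Rightarrow> (real \<Rightarrow> real) \<Rightarrow> real set \<Rightarrow> real set \<Rightarrow> (real \<Rightarrow> real) \<Rightarrow> real set" where
  "next_region P lam w D R v =
     {x \<in> R. pde_res P w D v x \<le> lam * (opM_res P w D v x - v x)}"

primrec solve_impulse_control ::
  "impulse_problem \<Rightarrow> real \<Rightarrow> real set \<Rightarrow> (real \<Rightarrow> real) \<Rightarrow> real set \<Rightarrow> (real \<Rightarrow> real) \<Rightarrow> real set \<Rightarrow>
     nat \<Rightarrow> (real \<Rightarrow> real) \<times> real set" where
  "solve_impulse_control P lam R w D v0 I0 0 = (v0, I0)"
| "solve_impulse_control P lam R w D v0 I0 (Suc k) =
     (let (v, I) = solve_impulse_control P lam R w D v0 I0 k;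
          v' = (THE v'. step_system P w D I v v')
      in (v', next_region P lam w D R v'))"

text \<open>
  The zero impulse, the only one available at nonnegative points, does not move the state. If
  this fails, \<open>Mv \<le> v\<close> at the nonnegative points is a genuine constraint of the limit equation,
  which an iteration with all regions inside the negative points never enforces. Example: grid
  \<open>{-1, 0, 1} = D\<close>, \<open>L = - Id\<close>, \<open>Z(-1) = {0}\<close>, \<open>f = (0, -10, 10)\<close>, \<open>c = 1\<close>, and \<open>B\<close> with row
  \<open>0\<close> the unit row at \<open>1\<close>, row \<open>1\<close> zero, row \<open>-1\<close> the unit row at \<open>0\<close>. The iteration stays at
  \<open>v(0) = -10\<close>, \<open>v(1) = 10\<close>, where \<open>(Mv - v)(0) = 19 > 0\<close>. If the identity does hold, both
  choices of \<open>R\<close> produce the same iteration from \<open>I\<^sup>0 = {}\<close>.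
\<close>

definition zero_impulse_trivial :: "impulse_problem \<Rightarrow> bool" where
  "zero_impulse_trivial P \<longleftrightarrow>
     (\<forall>\<delta>\<in>controls P. \<forall>x\<in>grid P. 0 \<le> x \<longrightarrow> (\<forall>y\<in>grid P. opB P \<delta> x y = id_mat x y))"

end

theory Submission
  imports Defs
begin

text \<open>
  On \<open>D\<close> the assumptions turn into three facts: \<open>L\<close> has nonnegative off-diagonal entries and
  negative row sums, every \<open>B(\<delta>)\<close> is substochastic (nonnegative entries, row sums at most
  \<open>1\<close>), and a row of \<open>B(\<delta>)\<close> whose sum over \<open>D\<close> is still \<open>1\<close> has no mass outside \<open>D\<close>, so
  that its restricted cost is the original, positive one. The locale \<open>monotone_qvi\<close> records
  them.

  The sign pattern of \<open>L\<close> gives a discrete maximum principle: if \<open>Lq \<le> Lp\<close> on a set of points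
  and \<open>p \<le> q\<close> on its complement, then \<open>p \<le> q\<close>. Since the step of the iteration is explicit on
  the intervention region, \<open>v' = Mv\<close> there, it is a Dirichlet problem for \<open>L\<close> with prescribed
  values on the region, and such problems are uniquely solvable.

  \<^emph>\<open>Monotonicity.\<close> The thresholded region at \<open>v\<^sup>k\<close> is the set where \<open>Lv\<^sup>k + f\<close> is at most
  \<open>\<lambda>(Mv\<^sup>k - v\<^sup>k)\<close>. Once \<open>v\<^sup>k\<^sup>-\<^sup>1 \<le> v\<^sup>k\<close>, each point carries one of two pieces of information:
  it was just computed by the linear equation, so \<open>Lv\<^sup>k + f = 0\<close>, or by the impulse, so
  \<open>v\<^sup>k = Mv\<^sup>k\<^sup>-\<^sup>1 \<le> Mv\<^sup>k\<close>. Either way, whichever of the two expressions is the larger one is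
  nonnegative at a tested point (and \<open>Lv\<^sup>k + f = 0\<close> at an untested one), and this is exactly what the comparison of \<open>v\<^sup>k\<close> with \<open>v\<^sup>k\<^sup>+\<^sup>1\<close> needs. Starting from
  the empty region makes the first step free of any condition on the initial guess.

  \<^emph>\<open>Convergence.\<close> A large constant is a supersolution and bounds the iterates, so they converge.
  At a tested point, \<open>max (Lv\<^sup>k + f) (\<lambda>(Mv\<^sup>k - v\<^sup>k))\<close> is either
  \<open>\<lambda>(v\<^sup>k\<^sup>+\<^sup>1 - v\<^sup>k)\<close> or \<open>L(v\<^sup>k - v\<^sup>k\<^sup>+\<^sup>1)\<close>. Both vanish in the limit, which therefore solves the
  equation there; \<open>\<lambda> > 0\<close> can be dropped from a maximum that equals \<open>0\<close>. At an untested point the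
  limit satisfies the linear equation, and \<open>Mv \<le> v\<close> holds if the only impulse there is a costly one
  that does not move the state.

  \<^emph>\<open>Uniqueness.\<close> Suppose that \<open>u - v\<close> has a positive maximum for two solutions \<open>u\<close>, \<open>v\<close>, and
  choose among the maximising points one where \<open>u\<close> is largest. The maximum principle forces an
  impulse of \<open>u\<close> there, and the impulse leads, with total mass \<open>1\<close>, to maximising points only, where
  \<open>u\<close> is no larger. As the impulse costs a positive amount, this is absurd.
\<close>

section \<open>Finite maxima and matrix-vector products\<close>

lemma finite_attains_max:
  fixes h :: "'a \<Rightarrow> real"
  assumes "finite S" "S \<noteq> {}"
  obtains x where "x \<in> S" "\<And>y. y \<in> S \<Longrightarrow> h y \<le> h x"
proof -
  from assms have "Max (h ` S) \<in> h ` S" by simp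
  then obtain x where "x \<in> S" "h x = Max (h ` S)" by auto
  moreover have "h y \<le> Max (h ` S)" if "y \<in> S" for y
    using assms(1) that by simp
  ultimately show thesis using that by metis
qed

lemma tendsto_Max_image:
  fixes F :: "'k \<Rightarrow> 'c \<Rightarrow> real"
  assumes "finite C" "C \<noteq> {}" "\<And>d. d \<in> C \<Longrightarrow> ((\<lambda>k. F k d) \<longlongrightarrow> l d) A"
  shows "((\<lambda>k. Max (F k ` C)) \<longlongrightarrow> Max (l ` C)) A"
  using assms
proof (induction C rule: finite_ne_induct)
  case (insert d C)
  then have "((\<lambda>k. max (F k d) (Max (F k ` C))) \<longlongrightarrow> max (l d) (Max (l ` C))) A"
    by (intro tendsto_max) auto
  with insert.hyps show ?case by simp
qed simp

lemma mat_vec_diff: "mat_vec S A (\<lambda>y. p y - q y) x = mat_vec S A p x - mat_vec S A q x"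
  by (simp add: mat_vec_def right_diff_distrib sum_subtractf)

lemma mat_vec_const: "mat_vec S A (\<lambda>_. K) x = K * (\<Sum>y\<in>S. A x y)"
  by (simp add: mat_vec_def sum_distrib_left mult.commute)

lemma mat_vec_cong: "(\<And>y. y \<in> S \<Longrightarrow> p y = q y) \<Longrightarrow> mat_vec S A p x = mat_vec S A q x"
  by (simp add: mat_vec_def)

lemma tendsto_mat_vec:
  assumes "\<And>y. y \<in> S \<Longrightarrow> (\<lambda>k. p k y) \<longlonglongrightarrow> q y"
  shows "(\<lambda>k. mat_vec S A (p k) x) \<longlonglongrightarrow> mat_vec S A q x"
  unfolding mat_vec_def by (intro tendsto_sum tendsto_mult tendsto_const assms)

section \<open>Monotone quasi-variational inequalities\<close>

text \<open>
  The costs may be negative on rows of mass less than \<open>1\<close>: restriction to \<open>D\<close> moves the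
  contribution of the prescribed values outside \<open>D\<close> into the cost.
\<close>

locale monotone_qvi =
  fixes D :: "real set" and L :: "real \<Rightarrow> real \<Rightarrow> real" and f :: "real \<Rightarrow> real"
    and C :: "'c set" and B :: "'c \<Rightarrow> real \<Rightarrow> real \<Rightarrow> real" and c :: "'c \<Rightarrow> real \<Rightarrow> real"
  assumes finite_D: "finite D" and finite_C: "finite C" and C_nonempty: "C \<noteq> {}"
    and L_offdiag: "x \<in> D \<Longrightarrow> y \<in> D \<Longrightarrow> x \<noteq> y \<Longrightarrow> 0 \<le> L x y"
    and L_rowsum: "x \<in> D \<Longrightarrow> (\<Sum>y\<in>D. L x y) < 0"
    and B_nonneg: "d \<in> C \<Longrightarrow> x \<in> D \<Longrightarrow> y \<in> D \<Longrightarrow> 0 \<le> B d x y"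
    and B_rowsum: "d \<in> C \<Longrightarrow> x \<in> D \<Longrightarrow> (\<Sum>y\<in>D. B d x y) \<le> 1"
    and stochastic_row_costs: "d \<in> C \<Longrightarrow> x \<in> D \<Longrightarrow> (\<Sum>y\<in>D. B d x y) = 1 \<Longrightarrow> 0 < c d x"
begin

definition pde :: "(real \<Rightarrow> real) \<Rightarrow> real \<Rightarrow> real" where
  "pde v x = mat_vec D L v x + f x"

definition opM :: "(real \<Rightarrow> real) \<Rightarrow> real \<Rightarrow> real" where
  "opM v x = Max ((\<lambda>d. mat_vec D (B d) v x - c d x) ` C)"

text \<open>
  Replacing the entries of \<open>p\<close> by their maximum can only increase the off-diagonal terms, whose
  coefficients are nonnegative, and leaves the diagonal term unchanged.
\<close>

lemma L_at_maximum:
  assumes "x \<in> D" "\<And>y. y \<in> D \<Longrightarrow> p y \<le> p x"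
  shows "mat_vec D L p x \<le> p x * (\<Sum>y\<in>D. L x y)"
proof -
  have "L x y * p y \<le> p x * L x y" if "y \<in> D" for y
  proof (cases "y = x")
    case False
    then show ?thesis
      using mult_left_mono[OF assms(2)[OF that] L_offdiag[of x y]] assms(1) that
      by (simp add: mult.commute)
  qed simp
  then show ?thesis
    unfolding mat_vec_def sum_distrib_left by (rule sum_mono)
qed

text \<open>
  Outside \<open>J\<close> a positive maximum of \<open>p - q\<close> would make \<open>L(p - q)\<close> negative there, because the
  row sums of \<open>L\<close> are negative.
\<close>

lemma comparison:
  assumes pde: "\<And>x. x \<in> D - J \<Longrightarrow> mat_vec D L q x \<le> mat_vec D L p x"
    and bdry: "\<And>x. x \<in> D \<inter> J \<Longrightarrow> p x \<le> q x"
    and "z \<in> D"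
  shows "p z \<le> q z"
proof -
  obtain x where x: "x \<in> D" "\<And>y. y \<in> D \<Longrightarrow> p y - q y \<le> p x - q x"
    using finite_attains_max[of D "\<lambda>y. p y - q y"] finite_D \<open>z \<in> D\<close> by blast
  have "p x - q x \<le> 0"
  proof (cases "x \<in> J")
    case True
    with bdry x(1) show ?thesis by simp
  next
    case False
    then have "0 \<le> mat_vec D L (\<lambda>y. p y - q y) x"
      using pde x(1) by (simp add: mat_vec_diff)
    also have "\<dots> \<le> (p x - q x) * (\<Sum>y\<in>D. L x y)"
      using L_at_maximum[of x "\<lambda>y. p y - q y"] x by simp
    finally show ?thesis
      using L_rowsum[OF x(1)] by (simp add: zero_le_mult_iff)
  qed
  with x(2)[OF \<open>z \<in> D\<close>] show ?thesis by simp
qed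

text \<open>
  Solvability by adding one interior point \<open>s\<close> at a time. The solutions for a smaller interior
  form a family \<open>p + t h\<close>, where \<open>h\<close> is the homogeneous solution with boundary value \<open>1\<close> at
  \<open>s\<close> and \<open>0\<close> elsewhere, and \<open>t\<close> is the still free value at \<open>s\<close>. By comparison with the
  constant \<open>1\<close>, \<open>h\<close> is largest at \<open>s\<close>, so \<open>(Lh)(s) < 0\<close> and \<open>t\<close> can be chosen to satisfy
  the equation at \<open>s\<close>.
\<close>

lemma dirichlet_problem_solvable:
  assumes "S \<subseteq> D"
  shows "\<exists>v. (\<forall>x. x \<notin> S \<longrightarrow> v x = g x) \<and> (\<forall>x\<in>S. mat_vec D L v x = b x)"
  using finite_subset[OF assms finite_D] assms
proof (induction S arbitrary: g b rule: finite_induct)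
  case empty
  then show ?case by auto
next
  case (insert s S)
  then have sD: "s \<in> D" and SD: "S \<subseteq> D" by auto
  obtain p where p: "\<And>x. x \<notin> S \<Longrightarrow> p x = (g(s := 0)) x" "\<And>x. x \<in> S \<Longrightarrow> mat_vec D L p x = b x"
    using insert.IH[OF SD, of "g(s := 0)" b] by blast
  obtain h where h: "\<And>x. x \<notin> S \<Longrightarrow> h x = (if x = s then 1 else 0)"
    "\<And>x. x \<in> S \<Longrightarrow> mat_vec D L h x = 0"
    using insert.IH[OF SD, of "\<lambda>x. if x = s then 1 else 0" "\<lambda>_. 0"] by blast
  have "mat_vec D L (\<lambda>_. 1) x \<le> mat_vec D L h x" if "x \<in> D - - S" for x
    using that h(2)[of x] L_rowsum[of x] by (simp add: mat_vec_def)
  then have h_le: "h x \<le> 1" if "x \<in> D" for x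
    using comparison[of "- S" "\<lambda>_. 1" h x] that h(1) by fastforce
  have "mat_vec D L h s \<le> h s * (\<Sum>y\<in>D. L s y)"
    using L_at_maximum[OF sD, of h] h_le h(1)[OF insert.hyps(2)] by simp
  then have pivot: "mat_vec D L h s < 0"
    using L_rowsum[OF sD] h(1)[OF insert.hyps(2)] by simp
  define t where "t = (b s - mat_vec D L p s) / mat_vec D L h s"
  define v where "v = (\<lambda>x. p x + t * h x)"
  have Lv: "mat_vec D L v x = mat_vec D L p x + t * mat_vec D L h x" for x
    by (simp add: v_def mat_vec_def distrib_left sum.distrib sum_distrib_left mult_ac)
  have "v x = g x" if "x \<notin> insert s S" for x
    using that p(1) h(1) by (simp add: v_def)
  moreover have "mat_vec D L v x = b x" if "x \<in> insert s S" for x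
    using that pivot by (auto simp: Lv t_def p(2) h(2))
  ultimately show ?case by blast
qed

lemma policy_le_opM: "d \<in> C \<Longrightarrow> mat_vec D (B d) v x - c d x \<le> opM v x"
  unfolding opM_def using finite_C by (intro Max_ge) auto

lemma opM_attained:
  obtains d where "d \<in> C" "opM v x = mat_vec D (B d) v x - c d x"
proof -
  have "opM v x \<in> (\<lambda>d. mat_vec D (B d) v x - c d x) ` C"
    unfolding opM_def using finite_C C_nonempty by (intro Max_in) auto
  with that show thesis by auto
qed

lemma B_mono:
  assumes "d \<in> C" "x \<in> D" "\<And>y. y \<in> D \<Longrightarrow> p y \<le> q y"
  shows "mat_vec D (B d) p x \<le> mat_vec D (B d) q x"
  unfolding mat_vec_def using assms by (intro sum_mono mult_left_mono B_nonneg)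

lemma opM_mono:
  assumes "x \<in> D" "\<And>y. y \<in> D \<Longrightarrow> p y \<le> q y"
  shows "opM p x \<le> opM q x"
proof -
  obtain d where d: "d \<in> C" "opM p x = mat_vec D (B d) p x - c d x"
    by (rule opM_attained)
  then show ?thesis
    using B_mono[of d x p q] policy_le_opM[of d q x] assms by force
qed

text \<open>
  Each of the finitely many inequalities holds for all large \<open>K\<close>: those for \<open>L\<close> since its row sums
  are negative, those for a row of \<open>B\<close> of mass less than \<open>1\<close> since the defect multiplies \<open>K\<close>, and
  those for a row of mass \<open>1\<close> for every \<open>K\<close> since its cost is positive.
\<close>

lemma constant_supersolution:
  obtains K where "\<And>x. x \<in> D \<Longrightarrow> pde (\<lambda>_. K) x \<le> 0" "\<And>x. x \<in> D \<Longrightarrow> opM (\<lambda>_. K) x \<le> K"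
proof -
  have L: "\<forall>\<^sub>F K in at_top. pde (\<lambda>_. K) x \<le> 0" if "x \<in> D" for x
    using eventually_ge_at_top[of "f x / - (\<Sum>y\<in>D. L x y)"]
  proof eventually_elim
    case (elim K)
    then have "f x \<le> K * - (\<Sum>y\<in>D. L x y)"
      using L_rowsum[OF that] pos_divide_le_eq[of "- (\<Sum>y\<in>D. L x y)" "f x" K] by simp
    then show ?case by (simp add: pde_def mat_vec_const)
  qed
  have B: "\<forall>\<^sub>F K in at_top. mat_vec D (B d) (\<lambda>_. K) x - c d x \<le> K" if "x \<in> D" "d \<in> C" for x d
  proof (cases "(\<Sum>y\<in>D. B d x y) = 1")
    case True
    with that show ?thesis
      using stochastic_row_costs[of d x]
      by (simp add: mat_vec_const)
  next
    case False
    with that have pos: "0 < 1 - (\<Sum>y\<in>D. B d x y)"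
      using B_rowsum[of d x] by simp
    show ?thesis
      using eventually_ge_at_top[of "- c d x / (1 - (\<Sum>y\<in>D. B d x y))"]
    proof eventually_elim
      case (elim K)
      then have "- c d x \<le> K * (1 - (\<Sum>y\<in>D. B d x y))"
        using pos_divide_le_eq[OF pos] by blast
      then show ?case
        by (simp add: mat_vec_const algebra_simps)
    qed
  qed
  have "\<forall>\<^sub>F K in at_top. (\<forall>x\<in>D. pde (\<lambda>_. K) x \<le> 0) \<and>
      (\<forall>x\<in>D. \<forall>d\<in>C. mat_vec D (B d) (\<lambda>_. K) x - c d x \<le> K)"
    using L B by (intro eventually_conj eventually_ball_finite finite_D finite_C ballI) auto
  then obtain K where K: "\<forall>x\<in>D. pde (\<lambda>_. K) x \<le> 0"
      "\<forall>x\<in>D. \<forall>d\<in>C. mat_vec D (B d) (\<lambda>_. K) x - c d x \<le> K"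
    using eventually_happens[of _ "at_top :: real filter"] by fastforce
  have "opM (\<lambda>_. K) x \<le> K" if "x \<in> D" for x
    using K(2) that by (metis opM_attained)
  with K(1) that show thesis by blast
qed

text \<open>
  The uniqueness argument. The set \<open>E\<close> of the maximising points of \<open>u - v\<close> is closed under the
  optimal impulses of \<open>u\<close>; the choice of a point of \<open>E\<close> where \<open>u\<close> is largest rules out chains of
  impulses that would never leave \<open>E\<close>.
\<close>

lemma solution_le_solution:
  assumes u: "\<And>x. x \<in> D \<Longrightarrow> max (pde u x) (opM u x - u x) = 0"
    and v: "\<And>x. x \<in> D \<Longrightarrow> max (pde v x) (opM v x - v x) = 0"
    and "z \<in> D"
  shows "u z \<le> v z"
proof (rule ccontr)
  assume "\<not> u z \<le> v z"
  obtain a where a: "a \<in> D" "\<And>y. y \<in> D \<Longrightarrow> u y - v y \<le> u a - v a"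
    using finite_attains_max[of D "\<lambda>y. u y - v y"] finite_D \<open>z \<in> D\<close> by blast
  define m where "m = u a - v a"
  have m_ub: "u y - v y \<le> m" if "y \<in> D" for y
    using a(2) that by (simp add: m_def)
  have "0 < m" using m_ub[OF \<open>z \<in> D\<close>] \<open>\<not> u z \<le> v z\<close> by simp
  define E where "E = {x \<in> D. u x - v x = m}"
  have "finite E" "E \<noteq> {}" using finite_D a(1) by (auto simp: E_def m_def)
  then obtain x where x: "x \<in> E" "\<And>y. y \<in> E \<Longrightarrow> u y \<le> u x"
    using finite_attains_max[of E u] by blast
  then have xD: "x \<in> D" and xm: "u x - v x = m" by (auto simp: E_def)
  \<comment> \<open>If the linear equation held for \<open>u\<close> at \<open>x\<close>, then \<open>L(u - v)(x) \<ge> 0\<close> at a positive maximum.\<close>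
  have "pde u x \<noteq> 0"
  proof
    assume "pde u x = 0"
    with v[OF xD] have "0 \<le> mat_vec D L (\<lambda>y. u y - v y) x"
      by (simp add: mat_vec_diff pde_def max_def split: if_splits)
    also have "\<dots> \<le> m * (\<Sum>y\<in>D. L x y)"
      using L_at_maximum[of x "\<lambda>y. u y - v y"] xD xm m_ub by simp
    finally show False
      using mult_pos_neg[OF \<open>0 < m\<close> L_rowsum[OF xD]] by simp
  qed
  then have "u x = opM u x"
    using u[OF xD] by (auto simp: max_def split: if_splits)
  then obtain d where d: "d \<in> C" "u x = mat_vec D (B d) u x - c d x"
    by (metis opM_attained)
  \<comment> \<open>The impulse \<open>d\<close> is admissible for \<open>v\<close> as well, so the \<open>B d\<close>-average of \<open>u - v\<close> is at least
    its maximum \<open>m\<close>. Hence the row has mass \<open>1\<close> and is carried by \<open>E\<close>.\<close>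
  have "mat_vec D (B d) v x - c d x \<le> v x"
    using policy_le_opM[OF d(1), of v x] v[OF xD] by (simp add: max_def split: if_splits)
  then have "m \<le> mat_vec D (B d) (\<lambda>y. u y - v y) x"
    using d(2) xm by (simp add: mat_vec_diff)
  then have gap: "(\<Sum>y\<in>D. B d x y * (m - (u y - v y))) \<le> m * (\<Sum>y\<in>D. B d x y) - m"
    by (simp add: mat_vec_def right_diff_distrib sum_subtractf sum_distrib_left mult.commute)
  have terms: "0 \<le> B d x y * (m - (u y - v y))" if "y \<in> D" for y
    using B_nonneg[OF d(1) xD that] m_ub[OF that] by simp
  have total: "0 \<le> (\<Sum>y\<in>D. B d x y * (m - (u y - v y)))"
    by (rule sum_nonneg) (rule terms)
  have "0 \<le> m * ((\<Sum>y\<in>D. B d x y) - 1)"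
    using order_trans[OF total gap] by (simp add: algebra_simps)
  then have stoch: "(\<Sum>y\<in>D. B d x y) = 1"
    using B_rowsum[OF d(1) xD] \<open>0 < m\<close> by (simp add: zero_le_mult_iff)
  have "(\<Sum>y\<in>D. B d x y * (m - (u y - v y))) = 0"
    using gap stoch total by simp
  then have zero: "B d x y * (m - (u y - v y)) = 0" if "y \<in> D" for y
    using sum_nonneg_eq_0_iff[OF finite_D, of "\<lambda>y. B d x y * (m - (u y - v y))"] terms that by blast
  have "B d x y * u y \<le> B d x y * u x" if "y \<in> D" for y
  proof (cases "B d x y = 0")
    case False
    with zero[OF that] that have "y \<in> E" by (simp add: E_def)
    then show ?thesis
      using x(2) B_nonneg[OF d(1) xD that] by (intro mult_left_mono)
  qed simp
  then have "mat_vec D (B d) u x \<le> (\<Sum>y\<in>D. B d x y) * u x"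
    unfolding mat_vec_def sum_distrib_right by (rule sum_mono)
  with d(2) stoch stochastic_row_costs[OF d(1) xD] show False by simp
qed

end

section \<open>The iteration\<close>

text \<open>
  \<open>R\<close> is the set of tested points, and \<open>v 0\<close> is unconstrained because the empty region \<open>I 0\<close>
  keeps it from entering any equation.
\<close>

locale region_iteration = monotone_qvi D L f C B c
  for D L f and C :: "'c set" and B c +
  fixes lam :: real and R :: "real set" and v :: "nat \<Rightarrow> real \<Rightarrow> real" and I :: "nat \<Rightarrow> real set"
  assumes lam: "0 < lam" and R: "R \<subseteq> D"
    and I_0: "I 0 = {}"
    and I_Suc: "I (Suc k) = {x \<in> R. pde (v (Suc k)) x \<le> lam * (opM (v (Suc k)) x - v (Suc k) x)}"
    and v_pde: "x \<in> D - I k \<Longrightarrow> pde (v (Suc k)) x = 0"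
    and v_impulse: "x \<in> I k \<Longrightarrow> v (Suc k) x = opM (v k) x"
begin

lemma I_subset_R: "I k \<subseteq> R"
  by (cases k) (auto simp: I_0 I_Suc)

text \<open>
  One step of the monotonicity argument. The hypothesis on the preceding step is only asked for when
  \<open>I k\<close> is nonempty, so that \<open>k = 0\<close> satisfies it vacuously.
\<close>

lemma step_increasing:
  assumes "\<And>x y. x \<in> I k \<Longrightarrow> y \<in> D \<Longrightarrow> v k y \<le> v (Suc k) y" and "z \<in> D"
  shows "v (Suc k) z \<le> v (Suc (Suc k)) z"
proof (rule comparison[where J = "I (Suc k)" and p = "v (Suc k)" and q = "v (Suc (Suc k))"])
  have M: "v (Suc k) x \<le> opM (v (Suc k)) x" if "x \<in> I k" for x
    using opM_mono[of x "v k" "v (Suc k)"] assms(1) that I_subset_R[of k] R v_impulse[OF that]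
    by fastforce
  show "mat_vec D L (v (Suc (Suc k))) x \<le> mat_vec D L (v (Suc k)) x" if x: "x \<in> D - I (Suc k)" for x
  proof -
    have "0 \<le> pde (v (Suc k)) x"
    proof (cases "x \<in> I k")
      case True
      then have "lam * (opM (v (Suc k)) x - v (Suc k) x) < pde (v (Suc k)) x"
        using x I_subset_R[of k] by (auto simp: I_Suc)
      moreover have "0 \<le> lam * (opM (v (Suc k)) x - v (Suc k) x)"
        using M[OF True] lam by simp
      ultimately show ?thesis by simp
    next
      case False
      with x v_pde[of x k] show ?thesis by simp
    qed
    with v_pde[OF x] show ?thesis by (simp add: pde_def)
  qed
  show "v (Suc k) x \<le> v (Suc (Suc k)) x" if x: "x \<in> D \<inter> I (Suc k)" for x
  proof (cases "x \<in> I k")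
    case True
    with M x v_impulse[of x "Suc k"] show ?thesis by simp
  next
    case False
    then have "0 \<le> lam * (opM (v (Suc k)) x - v (Suc k) x)"
      using x v_pde[of x k] by (simp add: I_Suc)
    with lam x v_impulse[of x "Suc k"] show ?thesis by (simp add: zero_le_mult_iff)
  qed
qed (fact assms(2))

lemma increasing: "x \<in> D \<Longrightarrow> v (Suc k) x \<le> v (Suc (Suc k)) x"
proof (induction k arbitrary: x)
  case 0
  then show ?case using step_increasing[of 0] by (simp add: I_0)
next
  case (Suc k)
  then show ?case using step_increasing[of "Suc k"] by blast
qed

text \<open>
  The induction starts at \<open>v 1\<close>, the solution of the linear equation on all of \<open>D\<close>; the initial
  guess itself need not lie below \<open>q\<close>.
\<close>

lemma le_supersolution:
  assumes "\<And>x. x \<in> D \<Longrightarrow> pde q x \<le> 0" "\<And>x. x \<in> D \<Longrightarrow> opM q x \<le> q x" and "x \<in> D"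
  shows "v (Suc k) x \<le> q x"
  using assms(3)
proof (induction k arbitrary: x)
  case 0
  show ?case
  proof (rule comparison[where J = "{}" and p = "v (Suc 0)" and q = q])
    show "mat_vec D L q y \<le> mat_vec D L (v (Suc 0)) y" if "y \<in> D - {}" for y
      using that assms(1)[of y] v_pde[of y 0] by (simp add: I_0 pde_def)
  qed (use 0 in auto)
next
  case (Suc k)
  show ?case
  proof (rule comparison[where J = "I (Suc k)" and p = "v (Suc (Suc k))" and q = q])
    show "mat_vec D L q y \<le> mat_vec D L (v (Suc (Suc k))) y" if "y \<in> D - I (Suc k)" for y
      using that assms(1)[of y] v_pde[of y "Suc k"] by (simp add: pde_def)
    show "v (Suc (Suc k)) y \<le> q y" if "y \<in> D \<inter> I (Suc k)" for y
      using that opM_mono[of y "v (Suc k)" q] Suc.IH assms(2)[of y] v_impulse[of y "Suc k"]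
      by fastforce
  qed (fact Suc.prems)
qed

lemma convergent_on_D:
  obtains u where "\<And>x. x \<in> D \<Longrightarrow> (\<lambda>k. v k x) \<longlonglongrightarrow> u x"
proof -
  obtain K where K: "\<And>x. x \<in> D \<Longrightarrow> pde (\<lambda>_. K) x \<le> 0" "\<And>x. x \<in> D \<Longrightarrow> opM (\<lambda>_. K) x \<le> K"
    using constant_supersolution by blast
  have "\<exists>l. (\<lambda>k. v k x) \<longlonglongrightarrow> l" if x: "x \<in> D" for x
  proof -
    have "incseq (\<lambda>k. v (Suc k) x)" using increasing[OF x] by (intro incseq_SucI)
    moreover have "\<forall>k. v (Suc k) x \<le> K" using le_supersolution[of "\<lambda>_. K"] K x by blast
    ultimately obtain l where "(\<lambda>k. v (Suc k) x) \<longlonglongrightarrow> l"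
      using incseq_convergent by blast
    then have "(\<lambda>k. v k x) \<longlonglongrightarrow> l" by (rule LIMSEQ_imp_Suc)
    then show ?thesis by blast
  qed
  then show thesis using that by metis
qed

text \<open>
  The residual \<open>r k\<close> is controlled by the increments of the sequence, with no need to know how often
  \<open>x\<close> enters the regions. At an untested point only the linear equation is ever imposed.
\<close>

lemma limit_equations:
  assumes u: "\<And>x. x \<in> D \<Longrightarrow> (\<lambda>k. v k x) \<longlonglongrightarrow> u x" and "x \<in> D"
  shows "x \<in> R \<Longrightarrow> max (pde u x) (opM u x - u x) = 0"
    and "x \<notin> R \<Longrightarrow> pde u x = 0"
proof -
  have pde_lim: "(\<lambda>k. pde (v k) x) \<longlonglongrightarrow> pde u x"
    unfolding pde_def by (intro tendsto_add tendsto_mat_vec u tendsto_const)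
  have M_lim: "(\<lambda>k. opM (v k) x) \<longlonglongrightarrow> opM u x"
    unfolding opM_def using finite_C C_nonempty
    by (intro tendsto_Max_image tendsto_diff tendsto_mat_vec u tendsto_const) auto
  show "pde u x = 0" if "x \<notin> R"
  proof -
    have "pde (v (Suc k)) x = 0" for k
      using that \<open>x \<in> D\<close> I_subset_R[of k] v_pde[of x k] by blast
    with LIMSEQ_Suc[OF pde_lim] show ?thesis by (simp add: LIMSEQ_const_iff)
  qed
  show "max (pde u x) (opM u x - u x) = 0" if "x \<in> R"
  proof -
    define r where "r k = max (pde (v k) x) (lam * (opM (v k) x - v k x))" for k
    define e where "e k = \<bar>lam * (v (Suc k) x - v k x)\<bar> + \<bar>pde (v k) x - pde (v (Suc k)) x\<bar>" for k
    have "r \<longlonglongrightarrow> max (pde u x) (lam * (opM u x - u x))"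
      unfolding r_def
      by (intro tendsto_max tendsto_mult tendsto_diff tendsto_const pde_lim M_lim u \<open>x \<in> D\<close>)
    moreover have "r \<longlonglongrightarrow> 0"
    proof (rule tendsto_0_le[where f = e and K = 1])
      \<comment> \<open>The region at stage \<open>0\<close> is not given by the test, so the estimate starts at stage \<open>1\<close>.\<close>
      have "\<bar>r (Suc k)\<bar> \<le> e (Suc k)" for k
      proof (cases "x \<in> I (Suc k)")
        case True
        then have "r (Suc k) = lam * (v (Suc (Suc k)) x - v (Suc k) x)"
          using v_impulse[of x "Suc k"] by (simp add: r_def I_Suc max_def)
        then show ?thesis by (simp add: e_def)
      next
        case False
        then have "r (Suc k) = pde (v (Suc k)) x - pde (v (Suc (Suc k))) x"
          using v_pde[of x "Suc k"] \<open>x \<in> D\<close> that by (simp add: r_def I_Suc max_def)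
        then show ?thesis by (simp add: e_def)
      qed
      then show "\<forall>\<^sub>F k in sequentially. norm (r k) \<le> norm (e k) * 1"
        unfolding eventually_sequentially
        by (intro exI[of _ 1] allI impI) (auto simp: e_def elim!: order_trans dest!: Suc_le_D)
      have "e \<longlonglongrightarrow> \<bar>lam * (u x - u x)\<bar> + \<bar>pde u x - pde u x\<bar>"
        unfolding e_def
        by (intro tendsto_add tendsto_rabs tendsto_mult tendsto_diff tendsto_const pde_lim
            LIMSEQ_Suc[OF pde_lim] u LIMSEQ_Suc[OF u] \<open>x \<in> D\<close>)
      then show "e \<longlonglongrightarrow> 0" by simp
    qed
    ultimately have "max (pde u x) (lam * (opM u x - u x)) = 0"
      by (rule LIMSEQ_unique)
    with lam show ?thesis
      by (auto simp: max_def mult_le_0_iff split: if_splits)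
  qed
qed

end

section \<open>The restricted impulse control problem\<close>

lemma cost_positive:
  "impulse_setting P \<Longrightarrow> \<delta> \<in> controls P \<Longrightarrow> x \<in> grid P \<Longrightarrow> 0 < cost P \<delta> x"
  unfolding impulse_setting_def by blast

lemma extend_control_in_controls:
  assumes "impulse_setting P" and nonpos: "grid_nonpos P \<subseteq> D" and "D \<subseteq> grid P"
    and \<delta>: "\<delta> \<in> controls_res P D"
  shows "extend_control P D \<delta> \<in> controls P"
proof -
  have "(if x \<in> D then \<delta> x else 0) \<in> impZ P x" if x: "x \<in> grid P" for x
  proof (cases "x \<in> D")
    case True
    then show ?thesis using \<delta> by (auto simp: controls_res_def)
  next
    case False
    then have "0 \<le> x" using nonpos x by (force simp: grid_nonpos_def)
    with assms(1) x have "impZ P x = {0}" by (simp add: impulse_setting_def)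
    with False show ?thesis by simp
  qed
  then show ?thesis by (simp add: extend_control_def controls_def)
qed

text \<open>
  Dropping the columns outside \<open>D\<close> lowers the row sums of \<open>L\<close> and of \<open>B\<close>, since the dropped
  entries are nonnegative. If a row of \<open>B\<close> keeps mass \<open>1\<close>, all its dropped entries vanish, so the
  values \<open>w\<close> do not enter its restricted cost.
\<close>

lemma monotone_qvi_restricted:
  assumes set: "impulse_setting P" and A1: "A1 P" and A2: "A2 P"
    and nonpos: "grid_nonpos P \<subseteq> D" and DG: "D \<subseteq> grid P"
  shows "monotone_qvi D (opL P) (controls_res P D) (opB_res P D) (cost_res P w D)"
proof -
  have "symmetric_grid (grid P)" using set by (simp add: impulse_setting_def)
  then have finG: "finite (grid P)"
    unfolding symmetric_grid_def by (metis finite_atLeastAtMost_int finite_imageI)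
  then have finD: "finite D" using DG finite_subset by blast
  have split: "sum h (grid P) = sum h D + sum h (grid P - D)" for h :: "real \<Rightarrow> real"
    using sum.subset_diff[OF DG finG, of h] by simp
  show ?thesis
  proof
    show "finite D" by (fact finD)
    show "finite (controls_res P D)" "controls_res P D \<noteq> {}"
    proof -
      have Z: "finite (impZ P x)" "impZ P x \<noteq> {}" if "x \<in> D" for x
        using set DG that by (auto simp: impulse_setting_def)
      show "finite (controls_res P D)"
        unfolding controls_res_def by (rule finite_PiE[OF finD Z(1)])
      show "controls_res P D \<noteq> {}"
        unfolding controls_res_def using Z(2) by (simp add: PiE_eq_empty_iff)
    qed
  next
    fix x y assume "x \<in> D" "y \<in> D" "x \<noteq> y"
    then show "0 \<le> opL P x y"
      using A1 DG by (force simp: A1_def L0_matrix_def)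
  next
    fix x assume x: "x \<in> D"
    then have xG: "x \<in> grid P" using DG by blast
    have off: "0 \<le> opL P x y" if "y \<in> grid P - {x}" for y
      using A1 xG that by (force simp: A1_def L0_matrix_def)
    have "(\<Sum>y\<in>grid P - {x}. opL P x y) = (\<Sum>y\<in>grid P - {x}. \<bar>- opL P x y\<bar>)"
      using off by (intro sum.cong) auto
    also have "\<dots> < \<bar>- opL P x x\<bar>"
      using A1 xG by (auto simp: A1_def sdd_def)
    also have "\<dots> = - opL P x x"
      using A1 xG by (auto simp: A1_def L0_matrix_def)
    finally have "(\<Sum>y\<in>grid P. opL P x y) < 0"
      using sum.remove[OF finG xG, of "opL P x"] by simp
    moreover have "0 \<le> (\<Sum>y\<in>grid P - D. opL P x y)"
      using off x by (intro sum_nonneg) auto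
    ultimately show "(\<Sum>y\<in>D. opL P x y) < 0"
      using split[of "opL P x"] by simp
  next
    fix \<delta> x assume \<delta>: "\<delta> \<in> controls_res P D" and x: "x \<in> D"
    let ?d = "extend_control P D \<delta>"
    have d: "?d \<in> controls P" by (rule extend_control_in_controls[OF set nonpos DG \<delta>])
    have xG: "x \<in> grid P" using x DG by blast
    have nonneg: "0 \<le> opB P ?d x y" if "y \<in> grid P" for y
    proof (cases "y = x")
      case True
      with A2 d xG show ?thesis by (simp add: A2_def)
    next
      case False
      with A1 d xG that show ?thesis by (force simp: A1_def L0_matrix_def id_mat_def)
    qed
    show "0 \<le> opB_res P D \<delta> x y" if "y \<in> D" for y
      using nonneg that DG by (auto simp: opB_res_def)
    have "(\<Sum>y\<in>grid P - {x}. opB P ?d x y)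
        = (\<Sum>y\<in>grid P - {x}. \<bar>id_mat x y - opB P ?d x y\<bar>)"
      using nonneg by (intro sum.cong) (auto simp: id_mat_def)
    also have "\<dots> \<le> \<bar>id_mat x x - opB P ?d x x\<bar>"
      using A1 d xG by (auto simp: A1_def wdd_def)
    also have "\<dots> = 1 - opB P ?d x x"
      using A1 d xG by (auto simp: A1_def L0_matrix_def id_mat_def)
    finally have row: "(\<Sum>y\<in>grid P. opB P ?d x y) \<le> 1"
      using sum.remove[OF finG xG, of "opB P ?d x"] by simp
    have out: "0 \<le> (\<Sum>y\<in>grid P - D. opB P ?d x y)"
      using nonneg by (intro sum_nonneg) auto
    show "(\<Sum>y\<in>D. opB_res P D \<delta> x y) \<le> 1"
      using row out split[of "opB P ?d x"] by (simp add: opB_res_def)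
    assume "(\<Sum>y\<in>D. opB_res P D \<delta> x y) = 1"
    then have "(\<Sum>y\<in>grid P - D. opB P ?d x y) = 0"
      using row out split[of "opB P ?d x"] by (simp add: opB_res_def)
    then have "\<forall>y\<in>grid P - D. opB P ?d x y = 0"
      using sum_nonneg_eq_0_iff[of "grid P - D" "opB P ?d x"] finG nonneg by blast
    then have "cost_res P w D \<delta> x = cost P ?d x"
      by (simp add: cost_res_def opB_res_def mat_vec_def)
    then show "0 < cost_res P w D \<delta> x"
      using cost_positive[OF set d xG] by simp
  qed
qed

theorem theorem2p3p2:
  fixes P :: impulse_problem and lam :: real and w v0 :: "real \<Rightarrow> real" and D R :: "real set"
    and v :: "nat \<Rightarrow> real \<Rightarrow> real" and I :: "nat \<Rightarrow> real set"
  assumes "impulse_setting P"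
    and "A0 P" and "A1 P" and "A2 P"
    and "0 < lam"
    and "grid_nonpos P \<subseteq> D" and "D \<subseteq> grid P"
    and "R = D \<or> R = grid_neg P"
    and "v0 \<in> vecs D"
    and "\<And>k. v k = fst (solve_impulse_control P lam R w D v0 {} k)"
    and "\<And>k. I k = snd (solve_impulse_control P lam R w D v0 {} k)"
  shows "(\<forall>k. \<exists>!v'. step_system P w D (I k) (v k) v') \<and>
    (\<forall>k\<ge>1. \<forall>x\<in>D. v k x \<le> v (Suc k) x) \<and>
    (\<exists>u. qvi_solution P w D u \<and> (\<forall>u'. qvi_solution P w D u' \<longrightarrow> u' = u) \<and>
      (R = D \<or> zero_impulse_trivial P \<longrightarrow> (\<forall>x\<in>D. (\<lambda>k. v k x) \<longlonglongrightarrow> u x)))"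
proof -
  let ?C = "controls_res P D"
  interpret monotone_qvi D "opL P" "src_res P w D" ?C "opB_res P D" "cost_res P w D"
    using assms(1,3,4,6,7) by (rule monotone_qvi_restricted)
  have pde: "pde_res P w D = pde" and opM: "opM_res P w D = opM"
    by (simp_all add: fun_eq_iff pde_res_def pde_def opM_res_def opM_def)

  have step: "\<exists>!v'. step_system P w D J p v'" if J: "J \<subseteq> D" for J p
  proof (rule ex_ex1I)
    obtain q where q: "\<And>x. x \<notin> D - J \<Longrightarrow> q x = opM p x"
      "\<And>x. x \<in> D - J \<Longrightarrow> mat_vec D (opL P) q x = - src_res P w D x"
      using dirichlet_problem_solvable[of "D - J" "opM p" "\<lambda>x. - src_res P w D x"] by auto
    then have "step_system P w D J p (restrict q D)"
      using J mat_vec_cong[of D "restrict q D" q "opL P"]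
      by (auto simp: step_system_def vecs_def pde opM pde_def)
    then show "\<exists>v'. step_system P w D J p v'" by blast
  next
    have le: "q x \<le> r x" if "step_system P w D J p q" "step_system P w D J p r" "x \<in> D" for q r x
    proof (rule comparison[where J = J and p = q and q = r])
      show "mat_vec D (opL P) r y \<le> mat_vec D (opL P) q y" if "y \<in> D - J" for y
      proof -
        have "pde q y = 0" "pde r y = 0"
          using \<open>step_system P w D J p q\<close> \<open>step_system P w D J p r\<close> that
          by (auto simp: step_system_def pde)
        then show ?thesis by (simp add: pde_def)
      qed
    qed (use that in \<open>auto simp: step_system_def\<close>)
    fix q r assume qr: "step_system P w D J p q" "step_system P w D J p r"
    then have "q x = r x" if "x \<in> D" for x
      using le[OF qr that] le[OF qr(2,1) that] by simp
    moreover have "q \<in> D \<rightarrow>\<^sub>E UNIV" "r \<in> D \<rightarrow>\<^sub>E UNIV"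
      using qr by (simp_all add: step_system_def vecs_def)
    ultimately show "q = r" by (intro PiE_ext)
  qed

  \<comment> \<open>Stated for an arbitrary test set \<open>S\<close>: besides the given iteration, the one with \<open>S = D\<close> is used
    below to produce the solution, since it converges to it in every case.\<close>
  have iter: "region_iteration D (opL P) (src_res P w D) ?C (opB_res P D) (cost_res P w D)
        lam S (\<lambda>k. fst (solve_impulse_control P lam S w D v0 {} k))
        (\<lambda>k. snd (solve_impulse_control P lam S w D v0 {} k))
      \<and> (\<forall>k. snd (solve_impulse_control P lam S w D v0 {} k) \<subseteq> D)"
    if S: "S \<subseteq> D" for S
  proof -
    define vI where "vI k = solve_impulse_control P lam S w D v0 {} k" for k
    have Suc: "fst (vI (Suc k)) = (THE v'. step_system P w D (snd (vI k)) (fst (vI k)) v')"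
      "snd (vI (Suc k)) = next_region P lam w D S (fst (vI (Suc k)))" for k
      by (simp_all add: vI_def Let_def split_beta)
    have vI_0: "snd (vI 0) = {}" by (simp add: vI_def)
    have sub: "snd (vI k) \<subseteq> D" for k
      using S by (cases k) (auto simp: vI_0 Suc(2) next_region_def)
    have iterate: "step_system P w D (snd (vI k)) (fst (vI k)) (fst (vI (Suc k)))" for k
      unfolding Suc(1) by (rule theI'[OF step[OF sub]])
    have "region_iteration D (opL P) (src_res P w D) ?C (opB_res P D) (cost_res P w D)
        lam S (\<lambda>k. fst (vI k)) (\<lambda>k. snd (vI k))"
    proof
      show "0 < lam" by (fact assms(5))
      show "S \<subseteq> D" by (fact S)
      show "snd (vI 0) = {}" by (fact vI_0)
      show "snd (vI (Suc k)) = {x \<in> S. pde (fst (vI (Suc k))) x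
          \<le> lam * (opM (fst (vI (Suc k))) x - fst (vI (Suc k)) x)}" for k
        by (simp only: Suc(2) next_region_def pde opM)
      show "pde (fst (vI (Suc k))) x = 0" if "x \<in> D - snd (vI k)" for k x
        using iterate[of k] that by (simp add: step_system_def pde)
      show "fst (vI (Suc k)) x = opM (fst (vI k)) x" if "x \<in> snd (vI k)" for k x
        using iterate[of k] that by (simp add: step_system_def opM)
    qed
    with sub show ?thesis by (simp add: vI_def)
  qed

  have "grid_neg P \<subseteq> D" using assms(6) by (auto simp: grid_neg_def grid_nonpos_def)
  then have RD: "R \<subseteq> D" using assms(8) by auto
  then interpret R: region_iteration D "opL P" "src_res P w D" ?C "opB_res P D"
      "cost_res P w D" lam R v I
    using iter[OF RD] by (simp add: assms(10,11)[abs_def])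
  interpret D: region_iteration D "opL P" "src_res P w D" ?C "opB_res P D" "cost_res P w D" lam D
      "\<lambda>k. fst (solve_impulse_control P lam D w D v0 {} k)"
      "\<lambda>k. snd (solve_impulse_control P lam D w D v0 {} k)"
    using iter by blast

  have sol_cong: "qvi_solution P w D (restrict u D)"
    if "\<And>x. x \<in> D \<Longrightarrow> max (pde u x) (opM u x - u x) = 0" for u
  proof -
    have "pde (restrict u D) x = pde u x" "opM (restrict u D) x = opM u x" for x
      using mat_vec_cong[of D "restrict u D" u] by (simp_all add: pde_def opM_def)
    with that show ?thesis by (simp add: qvi_solution_def vecs_def pde opM)
  qed
  have unique: "u = u'" if "qvi_solution P w D u" "qvi_solution P w D u'" for u u'
  proof -
    have "max (pde u x) (opM u x - u x) = 0" "max (pde u' x) (opM u' x - u' x) = 0"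
      if "x \<in> D" for x
      using \<open>qvi_solution P w D u\<close> \<open>qvi_solution P w D u'\<close> that
      unfolding qvi_solution_def pde opM by blast+
    then have "u x = u' x" if "x \<in> D" for x
      using solution_le_solution[of u u' x] solution_le_solution[of u' u x] that
      by (meson order.antisym)
    moreover have "u \<in> D \<rightarrow>\<^sub>E UNIV" "u' \<in> D \<rightarrow>\<^sub>E UNIV"
      using that by (simp_all add: qvi_solution_def vecs_def)
    ultimately show ?thesis by (intro PiE_ext)
  qed
  obtain u where "\<And>x. x \<in> D \<Longrightarrow>
      (\<lambda>k. fst (solve_impulse_control P lam D w D v0 {} k) x) \<longlonglongrightarrow> u x"
    using D.convergent_on_D by blast
  then have u: "qvi_solution P w D (restrict u D)"
    using D.limit_equations(1) by (intro sol_cong) blast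

  have lim: "\<forall>x\<in>D. (\<lambda>k. v k x) \<longlonglongrightarrow> restrict u D x" if "R = D \<or> zero_impulse_trivial P"
  proof -
    obtain l where l: "\<And>x. x \<in> D \<Longrightarrow> (\<lambda>k. v k x) \<longlonglongrightarrow> l x"
      using R.convergent_on_D by blast
    have "max (pde l x) (opM l x - l x) = 0" if x: "x \<in> D" for x
    proof (cases "x \<in> R")
      case True
      show ?thesis
        by (rule R.limit_equations(1)[OF _ x True]) (rule l)
    next
      case False
      with x assms(7,8) that \<open>R = D \<or> zero_impulse_trivial P\<close>
      have xG: "x \<in> grid P" "0 \<le> x" and triv: "zero_impulse_trivial P"
        by (auto simp: grid_neg_def)
      obtain \<delta> where \<delta>: "\<delta> \<in> ?C"
        "opM l x = mat_vec D (opB_res P D \<delta>) l x - cost_res P w D \<delta> x"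
        by (rule opM_attained)
      have d: "extend_control P D \<delta> \<in> controls P"
        using assms(1,6,7) \<delta>(1) by (rule extend_control_in_controls)
      \<comment> \<open>At an untested point the impulse does not move the state, so \<open>(Ml - l)(x)\<close> is minus a cost and
        the linear equation alone makes the maximum vanish.\<close>
      have row: "opB_res P D \<delta> x y = id_mat x y" if "y \<in> grid P" for y
        using triv d xG that by (simp add: zero_impulse_trivial_def opB_res_def)
      have "mat_vec D (opB_res P D \<delta>) l x = (\<Sum>y\<in>D. id_mat x y * l y)"
        unfolding mat_vec_def using row assms(7) by (intro sum.cong) auto
      also have "\<dots> = l x"
        using x finite_D by (simp add: id_mat_def if_distrib[of "\<lambda>a. a * _"] cong: if_cong)
      finally have 1: "mat_vec D (opB_res P D \<delta>) l x = l x" .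
      have "mat_vec (grid P - D) (opB_res P D \<delta>) w x = 0"
        unfolding mat_vec_def using row x by (intro sum.neutral) (auto simp: id_mat_def)
      with 1 \<delta>(2) have "opM l x - l x = - cost P (extend_control P D \<delta>) x"
        by (simp add: cost_res_def)
      moreover have "0 < cost P (extend_control P D \<delta>) x"
        using assms(1) d xG(1) by (rule cost_positive)
      moreover have "pde l x = 0"
        by (rule R.limit_equations(2)[OF _ x False]) (rule l)
      ultimately show ?thesis by simp
    qed
    then have "restrict l D = restrict u D"
      by (rule unique[OF sol_cong u])
    then have "restrict u D x = l x" if "x \<in> D" for x
      using that by (metis restrict_apply)
    with l show ?thesis by simp
  qed

  have "\<exists>!v'. step_system P w D (I k) (v k) v'" for k
    using step[of "I k"] R.I_subset_R[of k] RD by blast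
  moreover have "v k x \<le> v (Suc k) x" if "1 \<le> k" "x \<in> D" for k x
    using R.increasing[OF that(2)] that(1) by (cases k) auto
  moreover have "\<exists>u. qvi_solution P w D u \<and> (\<forall>u'. qvi_solution P w D u' \<longrightarrow> u' = u) \<and>
      (R = D \<or> zero_impulse_trivial P \<longrightarrow> (\<forall>x\<in>D. (\<lambda>k. v k x) \<longlonglongrightarrow> u x))"
    by (intro exI[of _ "restrict u D"] conjI allI impI u unique lim)
  ultimately show ?thesis by (intro conjI allI impI ballI)
qed

end
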